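(* Let $X$ be a reflexive Banach space. Then $$\mu^{s}(X)\leqslant \operatorname{bs}(X^{*})\leqslant 4\mu^{s}(X).$$
   Context: Banach spaces are infinite-dimensional, over the real or complex field; $B_X$ denotes the closed unit ball of $X$, and $\mathcal F_X$ the family of all weakly compact subsets of $B_X$. The family of all subsequences of $(x_n)_{n=1}^\infty$ is denoted $\mathrm{ss}((x_n)_{n=1}^\infty)$. For a bounded sequence $(f_n)_{n=1}^\infty$ in $X^*$ define $$\alpha((f_n)_{n=1}^\infty)=\sup_{K\in\mathcal F_X}\limsup_{n\to\infty}\sup_{x\in K}|\langle f_n,x\rangle|,\qquad c\alpha((f_n)_{n=1}^\infty)=\alpha\Big(\Big(\tfrac1n\sum_{i=1}^n f_i\Big)_{n=1}^\infty\Big).$$ Define $$\mu^s(X)=\sup_{(f_n)}\ \inf_{(g_n)\in\mathrm{ss}((f_n))}\ \sup_{(h_n)\in\mathrm{ss}((g_n))}c\alpha((h_n)_{n=1}^\infty),$$ where the first supremum is over all weak$^*$ null sequences $(f_n)_{n=1}^\infty$ in $B_{X^*}$. For a bounded sequence $(x_n)_{n=1}^\infty$ in a Banach space set $\operatorname{ca}((x_n)_{n=1}^\infty)=\inf_{n\in\mathbb N}\sup_{k,l\geqslant n}\|x_k-x_l\|$ and $\mathrm{cca}((x_n)_{n=1}^\infty)=\operatorname{ca}\big((\frac1n\sum_{i=1}^n x_i)_{n=1}^\infty\big)$. For a Banach space $Y$ define $$\operatorname{bs}(Y)=\sup_{(x_n)_{n=1}^\infty\subseteq B_Y}\ \inf_{(y_n)\in\mathrm{ss}((x_n))}\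 \sup_{(z_n)\in\mathrm{ss}((y_n))}\mathrm{cca}((z_n)_{n=1}^\infty).$$ *)

theory Defs
  imports "HOL-Analysis.Analysis"
begin

(* The scalar fields: exactly those isometrically isomorphic, as normed real algebras,
   to the reals or to the complex numbers. *)
class real_or_complex = real_normed_field +
  assumes real_or_complex:
    "\<exists>\<phi> :: 'a \<Rightarrow> complex.
       (\<forall>x y. \<phi> (x + y) = \<phi> x + \<phi> y) \<and> (\<forall>x y. \<phi> (x * y) = \<phi> x * \<phi> y) \<and>
       (\<forall>r x. \<phi> (scaleR r x) = scaleR r (\<phi> x)) \<and> (\<forall>x. cmod (\<phi> x) = norm x) \<and>
       (range \<phi> = \<real> \<or> range \<phi> = UNIV)"

instance real :: real_or_complex
proof
  show "\<exists>\<phi> :: real \<Rightarrow> complex.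
       (\<forall>x y. \<phi> (x + y) = \<phi> x + \<phi> y) \<and> (\<forall>x y. \<phi> (x * y) = \<phi> x * \<phi> y) \<and>
       (\<forall>r x. \<phi> (scaleR r x) = scaleR r (\<phi> x)) \<and> (\<forall>x. cmod (\<phi> x) = norm x) \<and>
       (range \<phi> = \<real> \<or> range \<phi> = UNIV)"
    by (rule exI[of _ complex_of_real]) (simp add: Reals_def scaleR_conv_of_real)
qed

instance complex :: real_or_complex
proof
  show "\<exists>\<phi> :: complex \<Rightarrow> complex.
       (\<forall>x y. \<phi> (x + y) = \<phi> x + \<phi> y) \<and> (\<forall>x y. \<phi> (x * y) = \<phi> x * \<phi> y) \<and>
       (\<forall>r x. \<phi> (scaleR r x) = scaleR r (\<phi> x)) \<and> (\<forall>x. cmod (\<phi> x) = norm x) \<and>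
       (range \<phi> = \<real> \<or> range \<phi> = UNIV)"
    by (rule exI[of _ id]) simp
qed

(* A Banach space over 'k is the whole type 'a; completeness is the class banach. *)
locale banach_space_over = vector_space smul
  for smul :: "'k::real_or_complex \<Rightarrow> 'a::banach \<Rightarrow> 'a" +
  assumes smul_of_real: "smul (of_real r) x = scaleR r x"
    and norm_smul: "norm (smul c x) = norm c * norm x"

lemma banach_space_over_real:
  "banach_space_over (scaleR :: real \<Rightarrow> 'a::banach \<Rightarrow> 'a)"
  by unfold_locales (simp_all add: algebra_simps)

lemma banach_space_over_complex:
  "banach_space_over ((*) :: complex \<Rightarrow> complex \<Rightarrow> complex)"
  by unfold_locales (simp_all add: algebra_simps norm_mult scaleR_conv_of_real)

definition infinite_dimensional :: "('k::field \<Rightarrow> 'a::ab_group_add \<Rightarrow> 'a) \<Rightarrow> bool" where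
  "infinite_dimensional smul \<longleftrightarrow> \<not> (\<exists>B. finite B \<and> module.span smul B = UNIV)"

(* The elements of 'a =>L 'k are only real-linear, so the dual is the subspace of
   'k-linear ones, with the operator norm of 'a =>L 'k. *)
definition dual_space ::
    "('k::real_or_complex \<Rightarrow> 'a::banach \<Rightarrow> 'a) \<Rightarrow> ('a \<Rightarrow>\<^sub>L 'k) set" where
  "dual_space smul = {f. \<forall>c x. blinfun_apply f (smul c x) = c * blinfun_apply f x}"

lemma dual_space_real: "dual_space (scaleR :: real \<Rightarrow> 'a::banach \<Rightarrow> 'a) = UNIV"
  by (auto simp: dual_space_def blinfun.scaleR_right)

definition dual_smul :: "'k::real_or_complex \<Rightarrow> ('a::banach \<Rightarrow>\<^sub>L 'k) \<Rightarrow> ('a \<Rightarrow>\<^sub>L 'k)" where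
  "dual_smul c f = blinfun_mult_right c o\<^sub>L f"

lemma dual_smul_apply: "blinfun_apply (dual_smul c f) x = c * blinfun_apply f x"
  by (simp add: dual_smul_def)

(* The bidual; only the values on the dual space matter. *)
definition bidual ::
    "('k::real_or_complex \<Rightarrow> 'a::banach \<Rightarrow> 'a) \<Rightarrow> (('a \<Rightarrow>\<^sub>L 'k) \<Rightarrow> 'k) set" where
  "bidual smul = {\<Phi>.
     (\<forall>f\<in>dual_space smul. \<forall>g\<in>dual_space smul. \<Phi> (f + g) = \<Phi> f + \<Phi> g) \<and>
     (\<forall>c. \<forall>f\<in>dual_space smul. \<Phi> (dual_smul c f) = c * \<Phi> f) \<and>
     (\<exists>C. \<forall>f\<in>dual_space smul. norm (\<Phi> f) \<le> C * norm f)}"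

definition reflexive_space ::
    "('k::real_or_complex \<Rightarrow> 'a::banach \<Rightarrow> 'a) \<Rightarrow> bool" where
  "reflexive_space smul \<longleftrightarrow>
     (\<forall>\<Phi>\<in>bidual smul. \<exists>x. \<forall>f\<in>dual_space smul. \<Phi> f = blinfun_apply f x)"

definition weak_topology ::
    "('k::real_or_complex \<Rightarrow> 'a::banach \<Rightarrow> 'a) \<Rightarrow> 'a topology" where
  "weak_topology smul =
     topology_generated_by {blinfun_apply f -` U | f U. f \<in> dual_space smul \<and> open U}"

definition weakly_compact_in_ball ::
    "('k::real_or_complex \<Rightarrow> 'a::banach \<Rightarrow> 'a) \<Rightarrow> 'a set set" where
  "weakly_compact_in_ball smul = {K. K \<subseteq> cball 0 1 \<and> compactin (weak_topology smul) K}"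

definition weak_star_null :: "(nat \<Rightarrow> ('a::banach \<Rightarrow>\<^sub>L 'k::real_or_complex)) \<Rightarrow> bool" where
  "weak_star_null f \<longleftrightarrow> (\<forall>x. (\<lambda>n. blinfun_apply (f n) x) \<longlonglongrightarrow> 0)"

definition subsequences :: "(nat \<Rightarrow> 'b) \<Rightarrow> (nat \<Rightarrow> 'b) set" where
  "subsequences x = {x \<circ> r | r. strict_mono r}"

(* Sequences are indexed from 0: term n here is the mean of the first n + 1 terms. *)
definition cesaro :: "(nat \<Rightarrow> 'b::real_vector) \<Rightarrow> nat \<Rightarrow> 'b" where
  "cesaro x n = (1 / real (Suc n)) *\<^sub>R (\<Sum>i\<le>n. x i)"

(* All quantities are nonnegative suprema and infima, hence ennreal-valued; in particular
   the supremum over the empty set K is 0. *)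
definition alpha ::
    "('k::real_or_complex \<Rightarrow> 'a::banach \<Rightarrow> 'a) \<Rightarrow> (nat \<Rightarrow> ('a \<Rightarrow>\<^sub>L 'k)) \<Rightarrow> ennreal" where
  "alpha smul f = (SUP K \<in> weakly_compact_in_ball smul.
     limsup (\<lambda>n. SUP x\<in>K. ennreal (norm (blinfun_apply (f n) x))))"

definition c_alpha ::
    "('k::real_or_complex \<Rightarrow> 'a::banach \<Rightarrow> 'a) \<Rightarrow> (nat \<Rightarrow> ('a \<Rightarrow>\<^sub>L 'k)) \<Rightarrow> ennreal" where
  "c_alpha smul f = alpha smul (cesaro f)"

definition mu_s :: "('k::real_or_complex \<Rightarrow> 'a::banach \<Rightarrow> 'a) \<Rightarrow> ennreal" where
  "mu_s smul =
     (SUP f \<in> {f. (\<forall>n. f n \<in> dual_space smul \<inter> cball 0 1) \<and> weak_star_null f}.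
        INF g \<in> subsequences f. SUP h \<in> subsequences g. c_alpha smul h)"

definition ca :: "(nat \<Rightarrow> 'b::real_normed_vector) \<Rightarrow> ennreal" where
  "ca x = (INF n. SUP k\<in>{n..}. SUP l\<in>{n..}. ennreal (norm (x k - x l)))"

definition cca :: "(nat \<Rightarrow> 'b::real_normed_vector) \<Rightarrow> ennreal" where
  "cca x = ca (cesaro x)"

(* Y is the carrier of a linear subspace with the norm of the ambient type. *)
definition bs :: "'b::real_normed_vector set \<Rightarrow> ennreal" where
  "bs Y = (SUP x \<in> {x. \<forall>n::nat. x n \<in> Y \<inter> cball 0 1}.
     INF y \<in> subsequences x. SUP z \<in> subsequences y. cca z)"

end

theory Submission
  imports Defs
begin

text \<open>If \<open>X\<close> is reflexive, its unit ball is weakly compact, so \<open>alpha\<close> of a sequence of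
  functionals is the limit superior of the norms. For a weak-star null sequence \<open>y\<close>, letting
  \<open>l \<rightarrow> \<infinity>\<close> in \<open>y k - y l\<close> bounds the norms of the tail by the oscillation of the tail; applied
  to Cesaro means this gives the first inequality. For the second, every sequence in the dual
  ball has a weak-star convergent subsequence \<open>x n \<rightarrow> g\<close>; then \<open>(x n - g) / 2\<close> is weak-star null
  in the ball, and the oscillation of the means of \<open>x\<close> is at most \<open>2 + 2\<close> times the limit superior
  of the norms of the means of this sequence.\<close>

section \<open>The Hahn--Banach theorem\<close>

text \<open>\<open>X\<close> may be nonseparable, so the weak-star topology of the dual ball need
  not be metrizable, and a diagonal argument yields convergence on countably many points only.
  Reflexivity closes the gap: weak-star cluster points of a sequence stay in its norm-closed span,
  which is separable, and there countably many evaluations separate the elements. This step needs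
  extension of functionals on the dual, the weak compactness of the ball needs it on
  \<open>X\<close>; hence Hahn-Banach is developed for both at once. In the constant 4, one factor 2
  undoes the halving that returns \<open>x n - g\<close> to the unit ball; the other arises when the
  difference of two means is estimated by the sum of their norms. Replacing \<open>x\<close> by a
  subsequence beforehand is harmless, because it only shrinks the family over which the infimum in
  \<open>bs\<close> is taken.\<close>

definition sublinear :: "('a::real_vector \<Rightarrow> real) \<Rightarrow> bool" where
  "sublinear p \<longleftrightarrow>
     (\<forall>x y. p (x + y) \<le> p x + p y) \<and> (\<forall>t x. 0 \<le> t \<longrightarrow> p (t *\<^sub>R x) = t * p x)"

lemma sublinear_add: "sublinear p \<Longrightarrow> p (x + y) \<le> p x + p y"
  by (simp add: sublinear_def)

lemma sublinear_scaleR: "sublinear p \<Longrightarrow> 0 \<le> t \<Longrightarrow> p (t *\<^sub>R x) = t * p x"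
  by (simp add: sublinear_def)

lemma sublinear_zero: "sublinear p \<Longrightarrow> p 0 = 0"
  using sublinear_scaleR[of p 0 0] by simp

lemma sublinear_minus: "sublinear p \<Longrightarrow> - p (- x) \<le> p x"
  using sublinear_add[of p x "- x"] sublinear_zero[of p] by simp

text \<open>Applying \<open>scale\<close> with \<open>1 / t\<close> at the point
  \<open>t *\<^sub>R x\<close> yields the reverse inequality.\<close>

lemma sublinearI:
  assumes add: "\<And>x y. p (x + y) \<le> p x + p y"
    and zero: "p 0 = 0"
    and scale: "\<And>t x. 0 < t \<Longrightarrow> p (t *\<^sub>R x) \<le> t * p x"
  shows "sublinear p"
proof -
  have "p (t *\<^sub>R x) = t * p x" if "0 \<le> t" for t x
  proof (cases "t = 0")
    case False
    with that have t: "0 < t" by simp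
    have "p x \<le> (1 / t) * p (t *\<^sub>R x)"
      using scale[of "1 / t" "t *\<^sub>R x"] t by simp
    then have "t * p x \<le> p (t *\<^sub>R x)"
      using t by (simp add: field_simps)
    with scale[OF t] show ?thesis by (simp add: antisym)
  qed (simp add: zero)
  then show ?thesis using add by (simp add: sublinear_def)
qed

text \<open>The upper envelope for extensions pinned at \<open>y\<close>: a linear \<open>u\<close>
  below \<open>q\<close> with \<open>u y = q y\<close> satisfies
  \<open>u x = u (x + t *\<^sub>R y) - t * q y\<close> and so lies below \<open>slide q y\<close>.
  Conversely, \<open>slide q y (- y) \<le> - q y\<close> pins every linear functional below the
  slide.\<close>

definition slide :: "('a::real_vector \<Rightarrow> real) \<Rightarrow> 'a \<Rightarrow> 'a \<Rightarrow> real" where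
  "slide q y x = (INF t\<in>{0..}. q (x + t *\<^sub>R y) - t * q y)"

text \<open>The lower bound does not depend on \<open>t\<close>, which makes the real infimum in
  \<open>slide\<close> meaningful.\<close>

lemma slide_bound:
  assumes "sublinear q" "0 \<le> t"
  shows "- q (- x) \<le> q (x + t *\<^sub>R y) - t * q y"
  using sublinear_add[OF assms(1), of "x + t *\<^sub>R y" "- x"] sublinear_scaleR[OF assms, of y]
  by simp

lemma slide_le:
  assumes "sublinear q" "0 \<le> t"
  shows "slide q y x \<le> q (x + t *\<^sub>R y) - t * q y"
  unfolding slide_def
proof (rule cINF_lower)
  show "bdd_below ((\<lambda>t. q (x + t *\<^sub>R y) - t * q y) ` {0..})"
    using slide_bound[OF assms(1)] by (intro bdd_belowI2[of _ "- q (- x)"]) auto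
qed (use assms in auto)

lemma slide_greatest:
  assumes "\<And>t. 0 \<le> t \<Longrightarrow> c \<le> q (x + t *\<^sub>R y) - t * q y"
  shows "c \<le> slide q y x"
  unfolding slide_def by (rule cINF_greatest) (use assms in auto)

lemma slide_le_self: "sublinear q \<Longrightarrow> slide q y x \<le> q x"
  using slide_le[of q 0] by simp

text \<open>A shift \<open>t\<close> for \<open>x\<close> and a shift \<open>s\<close> for
  \<open>x'\<close> combine to the shift \<open>t + s\<close> for \<open>x + x'\<close>, and shifts
  rescale along with \<open>x\<close>. Each infimum is handled separately by moving the other one
  across the inequality.\<close>

lemma sublinear_slide:
  assumes q: "sublinear q"
  shows "sublinear (slide q y)"
proof (rule sublinearI)
  fix x x'
  have "slide q y (x + x') - slide q y x' \<le> slide q y x"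
  proof (rule slide_greatest)
    fix t :: real assume t: "0 \<le> t"
    have "slide q y (x + x') - (q (x + t *\<^sub>R y) - t * q y) \<le> slide q y x'"
    proof (rule slide_greatest)
      fix s :: real assume s: "0 \<le> s"
      have "slide q y (x + x') \<le> q ((x + x') + (t + s) *\<^sub>R y) - (t + s) * q y"
        using t s by (intro slide_le[OF q]) simp
      also have "(x + x') + (t + s) *\<^sub>R y = (x + t *\<^sub>R y) + (x' + s *\<^sub>R y)"
        by (simp add: algebra_simps)
      finally show "slide q y (x + x') - (q (x + t *\<^sub>R y) - t * q y)
          \<le> q (x' + s *\<^sub>R y) - s * q y"
        using sublinear_add[OF q, of "x + t *\<^sub>R y" "x' + s *\<^sub>R y"]
        by (simp add: algebra_simps)
    qed
    then show "slide q y (x + x') - slide q y x' \<le> q (x + t *\<^sub>R y) - t * q y" by simp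
  qed
  then show "slide q y (x + x') \<le> slide q y x + slide q y x'" by simp
next
  have "0 \<le> slide q y 0"
    by (rule slide_greatest) (simp add: sublinear_scaleR[OF q])
  then show "slide q y 0 = 0"
    using slide_le_self[OF q, of y 0] sublinear_zero[OF q] by simp
next
  fix t :: real and x assume t: "0 < t"
  have "slide q y (t *\<^sub>R x) / t \<le> slide q y x"
  proof (rule slide_greatest)
    fix s :: real assume s: "0 \<le> s"
    have "slide q y (t *\<^sub>R x) \<le> q (t *\<^sub>R x + (t * s) *\<^sub>R y) - (t * s) * q y"
      using t s by (intro slide_le[OF q]) simp
    also have "t *\<^sub>R x + (t * s) *\<^sub>R y = t *\<^sub>R (x + s *\<^sub>R y)"
      by (simp add: algebra_simps)
    also have "q \<dots> = t * q (x + s *\<^sub>R y)"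
      using t by (simp add: sublinear_scaleR[OF q])
    finally show "slide q y (t *\<^sub>R x) / t \<le> q (x + s *\<^sub>R y) - s * q y"
      using t by (simp add: field_simps)
  qed
  then show "slide q y (t *\<^sub>R x) \<le> t * slide q y x"
    using t by (simp add: field_simps)
qed

text \<open>For subadditivity, two members of the chain evaluated at different points are both
  replaced by the smaller one. The common majorant \<open>p\<close> bounds all values at
  \<open>x\<close> below by \<open>- p (- x)\<close>.\<close>

lemma sublinear_INF_chain:
  assumes "C \<noteq> {}" and sub: "\<And>q. q \<in> C \<Longrightarrow> sublinear q"
    and le: "\<And>q x. q \<in> C \<Longrightarrow> q x \<le> p x"
    and chain: "\<And>q r. q \<in> C \<Longrightarrow> r \<in> C \<Longrightarrow> q \<le> r \<or> r \<le> q"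
  shows "sublinear (\<lambda>x. INF q\<in>C. q x)" and "\<And>q. q \<in> C \<Longrightarrow> (INF q\<in>C. q x) \<le> q x"
proof -
  have lower: "(INF q\<in>C. q x) \<le> q x" if "q \<in> C" for q x
  proof (rule cINF_lower[OF _ that])
    have "- p (- x) \<le> q x" if "q \<in> C" for q
      using sublinear_minus[OF sub[OF that], of x] le[OF that, of "- x"] by simp
    then show "bdd_below ((\<lambda>q. q x) ` C)"
      by (intro bdd_belowI2[of _ "- p (- x)"]) auto
  qed
  then show "(INF q\<in>C. q x) \<le> q x" if "q \<in> C" for q
    using that .
  show "sublinear (\<lambda>x. INF q\<in>C. q x)"
  proof (rule sublinearI)
    fix x y
    have *: "(INF q\<in>C. q (x + y)) \<le> q x + r y" if qr: "q \<in> C" "r \<in> C" for q r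
    proof -
      obtain s where s: "s \<in> C" "s \<le> q" "s \<le> r"
        using chain[OF qr] qr by blast
      have "(INF q\<in>C. q (x + y)) \<le> s x + s y"
        using lower[OF s(1)] sublinear_add[OF sub[OF s(1)]] order_trans by blast
      then show ?thesis
        using s(2,3) by (meson add_mono le_funD order_trans)
    qed
    have "(INF q\<in>C. q (x + y)) - (INF q\<in>C. q y) \<le> (INF q\<in>C. q x)"
    proof (rule cINF_greatest[OF assms(1)])
      fix q assume q: "q \<in> C"
      have "(INF q\<in>C. q (x + y)) - q x \<le> (INF q\<in>C. q y)"
        by (rule cINF_greatest[OF assms(1)]) (use *[OF q] in \<open>simp add: algebra_simps\<close>)
      then show "(INF q\<in>C. q (x + y)) - (INF q\<in>C. q y) \<le> q x" by simp
    qed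
    then show "(INF q\<in>C. q (x + y)) \<le> (INF q\<in>C. q x) + (INF q\<in>C. q y)" by simp
  next
    have "(\<lambda>q. q 0) ` C = {0}"
      using assms(1) sublinear_zero[OF sub] by (auto simp: image_iff)
    then show "(INF q\<in>C. q 0) = 0" by simp
  next
    fix t :: real and x assume t: "0 < t"
    have "(INF q\<in>C. q (t *\<^sub>R x)) / t \<le> (INF q\<in>C. q x)"
    proof (rule cINF_greatest[OF assms(1)])
      fix q assume q: "q \<in> C"
      show "(INF q\<in>C. q (t *\<^sub>R x)) / t \<le> q x"
        using lower[OF q, of "t *\<^sub>R x"] t sublinear_scaleR[OF sub[OF q], of t x]
        by (simp add: field_simps)
    qed
    then show "(INF q\<in>C. q (t *\<^sub>R x)) \<le> t * (INF q\<in>C. q x)"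
      using t by (simp add: field_simps)
  qed
qed

text \<open>Minimality forces \<open>slide m y = m\<close>; the competitor \<open>t = 1\<close> in
  that infimum is then superadditivity.\<close>

lemma minimal_sublinear_linear:
  assumes m: "sublinear m"
    and min: "\<And>q. sublinear q \<Longrightarrow> q \<le> m \<Longrightarrow> q = m"
  shows "linear m"
proof -
  have "slide m y = m" for y
    by (intro min sublinear_slide[OF m] le_funI slide_le_self[OF m])
  then have "m x + m y \<le> m (x + y)" for x y
    using slide_le[OF m, of 1 y x] by simp
  with sublinear_add[OF m] have add: "m (x + y) = m x + m y" for x y
    by (simp add: antisym)
  have minus: "m (- x) = - m x" for x
    using add[of x "- x"] sublinear_zero[OF m] by simp
  show ?thesis
  proof (rule linearI)
    fix t :: real and x
    show "m (t *\<^sub>R x) = t *\<^sub>R m x"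
    proof (cases "0 \<le> t")
      case False
      then show ?thesis
        using sublinear_scaleR[OF m, of "- t" x] minus[of "t *\<^sub>R x"] by simp
    qed (simp add: sublinear_scaleR[OF m])
  qed (rule add)
qed

text \<open>Among the sublinear functionals below a given one, the minimal elements are linear, so
  that no partially defined functionals need to be extended. Starting below the slide of \<open>p\<close>
  along \<open>x\<^sub>0\<close> pins the value at \<open>x\<^sub>0\<close>.\<close>

theorem hahn_banach_sublinear:
  fixes p :: "'a::real_vector \<Rightarrow> real"
  assumes p: "sublinear p"
  obtains u where "linear u" "\<And>x. u x \<le> p x" "u x0 = p x0"
proof -
  define s where "s = slide p x0"
  have s: "sublinear s" unfolding s_def by (rule sublinear_slide[OF p])
  define A where "A = {q. sublinear q \<and> q \<le> s}"
  have "\<exists>m\<in>A. \<forall>a\<in>A. m \<ge> a \<longrightarrow> a = m"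
  proof (rule predicate_Zorn[where P = "(\<ge>)"])
    show "partial_order_on A (relation_of (\<ge>) A)"
      by (rule partial_order_on_relation_ofI) auto
  next
    fix C assume C: "C \<in> Chains (relation_of (\<ge>) A)"
    then have CA: "C \<subseteq> A" by (rule Chains_relation_of)
    show "\<exists>u\<in>A. \<forall>a\<in>C. a \<ge> u"
    proof (cases "C = {}")
      case True
      then show ?thesis using s by (auto simp: A_def)
    next
      case False
      have sub: "sublinear q" if "q \<in> C" for q using that CA by (auto simp: A_def)
      have le: "q x \<le> s x" if "q \<in> C" for q x using that CA by (auto simp: A_def le_fun_def)
      have chain: "q \<le> r \<or> r \<le> q" if "q \<in> C" "r \<in> C" for q r
        using C that by (auto simp: Chains_def relation_of_def)
      define u where "u = (\<lambda>x. INF q\<in>C. q x)"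
      have "sublinear u" unfolding u_def
        by (rule sublinear_INF_chain(1)[where C = C and p = s]) (fact False sub le chain)+
      moreover have lower: "u x \<le> q x" if "q \<in> C" for q x
        unfolding u_def
        by (rule sublinear_INF_chain(2)[where C = C and p = s]) (fact False sub le chain that)+
      moreover have "u \<le> s"
      proof -
        obtain q where q: "q \<in> C" using False by blast
        show ?thesis by (rule le_funI) (rule order_trans[OF lower[OF q] le[OF q]])
      qed
      ultimately show ?thesis by (auto simp: A_def le_fun_def)
    qed
  qed
  then obtain m where m: "sublinear m" "m \<le> s"
    and min: "\<And>q. sublinear q \<Longrightarrow> q \<le> s \<Longrightarrow> q \<le> m \<Longrightarrow> q = m"
    by (auto simp: A_def)
  have lin: "linear m"
    by (rule minimal_sublinear_linear) (use m min in \<open>auto intro: order_trans\<close>)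
  have le: "m x \<le> p x" for x
    using le_funD[OF m(2), of x] slide_le_self[OF p, of x0 x] by (simp add: s_def)
  \<comment> \<open>The shift \<open>t = 1\<close> moves \<open>- x0\<close> to the origin, where
    \<open>p\<close> vanishes.\<close>
  have "m (- x0) \<le> - p x0"
    using le_funD[OF m(2), of "- x0"] slide_le[OF p, of 1 x0 "- x0"] sublinear_zero[OF p]
    by (simp add: s_def)
  then have "m x0 = p x0"
    using le[of x0] linear_neg[OF lin, of x0] by simp
  with lin le that show thesis by blast
qed

section \<open>Scalar fields\<close>

text \<open>Isometry is stated through \<open>dist\<close>, the form that gives injectivity and
  continuity of the inverse directly.\<close>

definition scalar_embedding :: "('k::real_or_complex \<Rightarrow> complex) \<Rightarrow> bool" where
  "scalar_embedding \<phi> \<longleftrightarrow>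
     (\<forall>x y. \<phi> (x + y) = \<phi> x + \<phi> y) \<and> (\<forall>x y. \<phi> (x * y) = \<phi> x * \<phi> y) \<and>
     (\<forall>r. \<phi> (of_real r) = of_real r) \<and> (\<forall>x y. dist (\<phi> x) (\<phi> y) = dist x y) \<and>
     (range \<phi> = \<real> \<or> range \<phi> = UNIV)"

lemma ex_scalar_embedding: "\<exists>\<phi> :: 'k::real_or_complex \<Rightarrow> complex. scalar_embedding \<phi>"
proof -
  obtain \<phi> :: "'k \<Rightarrow> complex" where add: "\<And>x y. \<phi> (x + y) = \<phi> x + \<phi> y"
    and mult: "\<And>x y. \<phi> (x * y) = \<phi> x * \<phi> y"
    and scale: "\<And>r x. \<phi> (scaleR r x) = scaleR r (\<phi> x)"
    and norm: "\<And>x. cmod (\<phi> x) = norm x"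
    and ran: "range \<phi> = \<real> \<or> range \<phi> = UNIV"
    using real_or_complex by blast
  have "\<phi> 1 * \<phi> 1 = \<phi> 1" using mult[of 1 1] by simp
  moreover have "\<phi> 1 \<noteq> 0" using norm[of 1] by auto
  ultimately have "\<phi> 1 = 1" by simp
  then have "\<phi> (of_real r) = of_real r" for r
    by (simp add: of_real_def scale)
  moreover have "dist (\<phi> x) (\<phi> y) = dist x y" for x y
  proof -
    have "\<phi> x = \<phi> (x - y) + \<phi> y" using add[of "x - y" y] by simp
    then show ?thesis by (simp add: dist_norm norm)
  qed
  ultimately have "scalar_embedding \<phi>"
    unfolding scalar_embedding_def using add mult ran by simp
  then show ?thesis by blast
qed

text \<open>This permits real and imaginary parts without leaving \<open>'k\<close>: in the complex
  case \<open>i\<close> is a preimage of the imaginary unit, and the last property is the estimate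
  of the real part by the modulus.\<close>

lemma scalar_cases:
  obtains (real) "\<And>c::'k::real_or_complex. \<exists>r. c = of_real r"
  | (complex) i :: "'k::real_or_complex" where "i * i = - 1" "\<And>c::'k::real_or_complex. \<exists>a b. c = of_real a + i * of_real b"
      "\<And>a b. \<bar>a\<bar> \<le> norm (of_real a + i * of_real b)"
proof -
  obtain \<phi> :: "'k \<Rightarrow> complex" where add: "\<And>x y. \<phi> (x + y) = \<phi> x + \<phi> y"
    and mult: "\<And>x y. \<phi> (x * y) = \<phi> x * \<phi> y"
    and of_real: "\<And>r. \<phi> (of_real r) = of_real r"
    and dist: "\<And>x y. dist (\<phi> x) (\<phi> y) = dist x y"
    and ran: "range \<phi> = \<real> \<or> range \<phi> = UNIV"
    using ex_scalar_embedding[where 'k = 'k] unfolding scalar_embedding_def by auto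
  have inj: "x = y" if "\<phi> x = \<phi> y" for x y
    using that dist[of x y] by simp
  have norm: "norm x = cmod (\<phi> x)" for x
    using dist[of x 0] of_real[of 0] by (simp add: dist_norm)
  from ran show thesis
  proof
    assume "range \<phi> = \<real>"
    have "\<exists>r. c = of_real r" for c :: 'k
    proof -
      have "\<phi> c \<in> \<real>" using \<open>range \<phi> = \<real>\<close> by blast
      then obtain r where "\<phi> c = of_real r" by (rule Reals_cases)
      then have "c = of_real r" by (intro inj) (simp add: of_real)
      then show ?thesis ..
    qed
    then show thesis by (rule real)
  next
    assume "range \<phi> = UNIV"
    then obtain i where i: "\<phi> i = \<i>" by (metis surjD)
    have \<phi>: "\<phi> (of_real a + i * of_real b) = Complex a b" for a b
      by (simp add: add mult of_real i complex_eq_iff)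
    have "\<phi> (i * i) = \<phi> (- 1)"
      using of_real[of "- 1"] by (simp add: mult i)
    then have "i * i = - 1" by (rule inj)
    moreover have "\<exists>a b. c = of_real a + i * of_real b" for c :: 'k
    proof -
      have "c = of_real (Re (\<phi> c)) + i * of_real (Im (\<phi> c))"
        by (intro inj) (simp add: \<phi>)
      then show ?thesis by blast
    qed
    moreover have "\<bar>a\<bar> \<le> norm (of_real a + i * of_real b)" for a b
      using abs_Re_le_cmod[of "Complex a b"] by (simp add: norm \<phi>)
    ultimately show thesis by (rule complex)
  qed
qed

text \<open>The device for carrying compactness of balls and separability from the complex plane to
  \<open>'k\<close>. The left inverse \<psi> matters only on the closed set
  \<open>range \<phi>\<close>.\<close>

lemma scalar_retraction:
  obtains \<phi> :: "'k::real_or_complex \<Rightarrow> complex" and \<psi>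
  where "closed (range \<phi>)" "\<And>x y. dist (\<phi> x) (\<phi> y) = dist x y" "\<And>x. \<psi> (\<phi> x) = x"
    "continuous_on (range \<phi>) \<psi>" "\<phi> 0 = 0"
proof -
  obtain \<phi> :: "'k \<Rightarrow> complex" where of_real: "\<And>r. \<phi> (of_real r) = of_real r"
    and dist: "\<And>x y. dist (\<phi> x) (\<phi> y) = dist x y"
    and ran: "range \<phi> = \<real> \<or> range \<phi> = UNIV"
    using ex_scalar_embedding[where 'k = 'k] unfolding scalar_embedding_def by auto
  have "inj \<phi>" using dist by (metis dist_eq_0_iff injI)
  then have inv: "inv \<phi> (\<phi> x) = x" for x by simp
  have "continuous_on (range \<phi>) (inv \<phi>)"
    unfolding continuous_on_iff by (metis dist inv rangeE)
  moreover have "closed (range \<phi>)" using ran closed_complex_Reals by auto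
  ultimately show thesis using that[OF _ dist inv] of_real[of 0] by simp
qed

lemma compact_cball_scalar: "compact (cball (0::'k::real_or_complex) r)"
proof -
  obtain \<phi> :: "'k \<Rightarrow> complex" and \<psi> where cl: "closed (range \<phi>)"
    and dist: "\<And>x y. dist (\<phi> x) (\<phi> y) = dist x y" and inv: "\<And>x. \<psi> (\<phi> x) = x"
    and cont: "continuous_on (range \<phi>) \<psi>" and zero: "\<phi> 0 = 0"
    by (rule scalar_retraction) blast
  have norm: "norm (\<phi> x) = norm x" for x using dist[of x 0] zero by simp
  have "cball 0 r = \<psi> ` (cball 0 r \<inter> range \<phi>)"
  proof (intro equalityI subsetI)
    fix x :: 'k assume "x \<in> cball 0 r"
    then show "x \<in> \<psi> ` (cball 0 r \<inter> range \<phi>)"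
      by (intro image_eqI[of _ _ "\<phi> x"]) (auto simp: inv norm)
  qed (auto simp: inv norm)
  moreover have "compact (\<psi> ` (cball 0 r \<inter> range \<phi>))"
  proof (rule compact_continuous_image)
    show "continuous_on (cball 0 r \<inter> range \<phi>) \<psi>"
      by (rule continuous_on_subset[OF cont]) simp
    show "compact (cball 0 r \<inter> range \<phi>)"
      using cl by (intro compact_Int_closed compact_cball)
  qed
  ultimately show ?thesis by simp
qed

lemma countable_dense_scalars:
  obtains S :: "'k::real_or_complex set" where "countable S" "closure S = UNIV"
proof -
  obtain \<phi> :: "'k \<Rightarrow> complex" and \<psi> where dist: "\<And>x y. dist (\<phi> x) (\<phi> y) = dist x y"
    and inv: "\<And>x. \<psi> (\<phi> x) = x"
    by (rule scalar_retraction) blast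
  obtain T where T: "countable T" "T \<subseteq> range \<phi>" "range \<phi> \<subseteq> closure T"
    using separable by blast
  have "x \<in> closure (\<psi> ` T)" for x
    unfolding closure_approachable
  proof (intro allI impI)
    fix e :: real assume "0 < e"
    moreover have "\<phi> x \<in> closure T" using T(3) by blast
    ultimately obtain t where t: "t \<in> T" "dist t (\<phi> x) < e"
      by (auto simp: closure_approachable)
    then obtain y where "t = \<phi> y" using T(2) by auto
    with t have "dist (\<psi> t) x < e" by (simp add: dist inv)
    with t(1) show "\<exists>y\<in>\<psi> ` T. dist y x < e" by blast
  qed
  with T(1) that[of "\<psi> ` T"] show thesis by auto
qed

section \<open>Bounded linear functionals\<close>

definition dist_to :: "'a::real_normed_vector set \<Rightarrow> 'a \<Rightarrow> real" where
  "dist_to M x = (INF m\<in>M. norm (x - m))"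

lemma dist_to_le: "m \<in> M \<Longrightarrow> dist_to M x \<le> norm (x - m)"
  unfolding dist_to_def by (rule cINF_lower) (auto intro: bdd_belowI2[of _ 0])

text \<open>A common setting for \<open>'a\<close> and for its functionals under
  \<open>dual_smul\<close>, so that one Hahn-Banach theorem serves both.\<close>

locale normed_space_over = vector_space smul
  for smul :: "'k::real_or_complex \<Rightarrow> 'a::real_normed_vector \<Rightarrow> 'a" +
  assumes smul_of_real: "smul (of_real r) x = scaleR r x"
    and norm_smul: "norm (smul c x) = norm c * norm x"
begin

lemma sublinear_dist_to:
  assumes M: "subspace M"
  shows "sublinear (dist_to M)"
proof (rule sublinearI)
  have ne: "M \<noteq> {}" using subspace_0[OF M] by auto
  fix x y
  have "dist_to M (x + y) - dist_to M y \<le> dist_to M x"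
    unfolding dist_to_def[of M x]
  proof (rule cINF_greatest[OF ne])
    fix m assume m: "m \<in> M"
    have "dist_to M (x + y) - norm (x - m) \<le> dist_to M y"
      unfolding dist_to_def[of M y]
    proof (rule cINF_greatest[OF ne])
      fix n assume "n \<in> M"
      then have "dist_to M (x + y) \<le> norm ((x + y) - (m + n))"
        using m by (intro dist_to_le subspace_add[OF M])
      also have "\<dots> \<le> norm (x - m) + norm (y - n)"
        by (rule norm_diff_triangle_ineq)
      finally show "dist_to M (x + y) - norm (x - m) \<le> norm (y - n)" by simp
    qed
    then show "dist_to M (x + y) - dist_to M y \<le> norm (x - m)" by simp
  qed
  then show "dist_to M (x + y) \<le> dist_to M x + dist_to M y" by simp
next
  show "dist_to M 0 = 0"
  proof (rule antisym)
    show "dist_to M 0 \<le> 0" using dist_to_le[OF subspace_0[OF M], of 0] by simp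
    show "0 \<le> dist_to M 0" unfolding dist_to_def
      using subspace_0[OF M] by (intro cINF_greatest) auto
  qed
next
  fix t :: real and x assume t: "0 < t"
  have "dist_to M (t *\<^sub>R x) / t \<le> dist_to M x"
    unfolding dist_to_def[of M x]
  proof (rule cINF_greatest)
    fix m assume "m \<in> M"
    then have "t *\<^sub>R m \<in> M" using subspace_scale[OF M, of m "of_real t"] by (simp add: smul_of_real)
    then have "dist_to M (t *\<^sub>R x) \<le> norm (t *\<^sub>R x - t *\<^sub>R m)" by (rule dist_to_le)
    also have "\<dots> = t * norm (x - m)"
      using t by (simp flip: scaleR_diff_right)
    finally show "dist_to M (t *\<^sub>R x) / t \<le> norm (x - m)"
      using t by (simp add: field_simps)
  qed (use subspace_0[OF M] in auto)
  then show "dist_to M (t *\<^sub>R x) \<le> t * dist_to M x"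
    using t by (simp add: field_simps)
qed

text \<open>Over the complex field this is the classical passage from a real part to its functional,
  \<open>F x = u x - i * u (i x)\<close>; over the reals \<open>F\<close> is \<open>u\<close>. The
  last two properties carry lower bounds and vanishing on subspaces from \<open>u\<close> to
  \<open>F\<close>.\<close>

lemma real_part_functional:
  assumes u: "linear u" and bound: "\<And>x. u x \<le> norm x"
  obtains F where "\<And>x y. F (x + y) = F x + F y" "\<And>c x. F (smul c x) = c * F x"
    "\<And>x. norm (F x) \<le> norm x" "\<And>x. \<bar>u x\<bar> \<le> norm (F x)"
    "\<And>x. (\<forall>c. u (smul c x) = 0) \<Longrightarrow> F x = 0"
proof (cases rule: scalar_cases[where 'k = 'k])
  case real
  define F :: "'a \<Rightarrow> 'k" where "F = (\<lambda>x. of_real (u x))"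
  have "F (smul c x) = c * F x" for c x
  proof -
    obtain r where "c = of_real r" using real by blast
    then show ?thesis by (simp add: F_def smul_of_real linear_scale[OF u])
  qed
  moreover have "norm (F x) \<le> norm x" for x
    using bound[of x] bound[of "- x"] by (simp add: F_def linear_neg[OF u])
  moreover have "F x = 0" if "\<forall>c. u (smul c x) = 0" for x
    using that[rule_format, of 1] by (simp add: F_def)
  ultimately show thesis
    by (intro that[of F]) (auto simp: F_def linear_add[OF u])
next
  case (complex i)
  define F :: "'a \<Rightarrow> 'k" where "F = (\<lambda>x. of_real (u x) + i * of_real (- u (smul i x)))"
  have i2: "i * (i * c) = - c" for c using complex(1) by (simp flip: mult.assoc)
  have add: "F (x + y) = F x + F y" for x y
    by (simp add: F_def linear_add[OF u] scale_right_distrib algebra_simps)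
  have F_real: "F (smul (of_real r) x) = of_real r * F x" for r x
  proof -
    have "smul i (r *\<^sub>R x) = r *\<^sub>R smul i x"
      by (metis scale_left_commute smul_of_real)
    then show ?thesis
      by (simp add: F_def smul_of_real linear_scale[OF u] algebra_simps)
  qed
  have "smul i (smul i x) = - x" for x
    using complex(1) by simp
  then have F_i: "F (smul i x) = i * F x" for x
    by (simp add: F_def linear_neg[OF u] algebra_simps i2)
  have scale: "F (smul c x) = c * F x" for c x
  proof -
    obtain a b where "c = of_real a + i * of_real b" using complex(2) by blast
    then show ?thesis
      by (simp add: scale_left_distrib add F_real F_i algebra_simps flip: scale_scale)
  qed
  have abs: "\<bar>u x\<bar> \<le> norm (F x)" for x
    unfolding F_def by (rule complex(3))
  have "norm (F x) \<le> norm x" for x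
  proof (cases "F x = 0")
    case False
    \<comment> \<open>A rotation of modulus one making \<open>F (smul c x)\<close> real and
      nonnegative, so that it must equal its real part \<open>u (smul c x)\<close>.\<close>
    define c where "c = of_real (norm (F x)) / F x"
    have "F (smul c x) = of_real (norm (F x))"
      using False by (simp add: scale c_def)
    \<comment> \<open>Real parts are compared inside \<open>'k\<close>: the difference is 0, and the
      norm of 0 dominates its real component.\<close>
    then have "0 = of_real (u (smul c x) - norm (F x)) + i * of_real (- u (smul i (smul c x)))"
      by (simp add: F_def algebra_simps)
    then have "\<bar>u (smul c x) - norm (F x)\<bar> \<le> 0"
      using complex(3)[of "u (smul c x) - norm (F x)" "- u (smul i (smul c x))"] by simp
    then have "norm (F x) \<le> norm (smul c x)" using bound[of "smul c x"] by simp
    also have "norm c = 1" using False by (simp add: c_def norm_divide)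
    then have "norm (smul c x) = norm x" by (simp add: norm_smul)
    finally show ?thesis .
  qed simp
  moreover have "F x = 0" if "\<forall>c. u (smul c x) = 0" for x
    using that[rule_format, of 1] that[rule_format, of i] by (simp add: F_def)
  ultimately show thesis using that[of F] add scale abs by blast
qed

text \<open>The majorant \<open>dist_to M\<close> lies below the norm and is 0 on \<open>M\<close>,
  so it yields the norm bound, the vanishing on \<open>M\<close> and the value at \<open>x0\<close>
  together. \<open>M = {0}\<close> gives norming functionals, \<open>M\<close> a span gives
  separation.\<close>

theorem hahn_banach:
  assumes M: "subspace M"
  obtains F where "\<And>x y. F (x + y) = F x + F y" "\<And>c x. F (smul c x) = c * F x"
    "\<And>x. norm (F x) \<le> norm x" "dist_to M x0 \<le> norm (F x0)" "\<And>m. m \<in> M \<Longrightarrow> F m = 0"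
proof -
  obtain u where u: "linear u" "\<And>x. u x \<le> dist_to M x" "u x0 = dist_to M x0"
    using hahn_banach_sublinear[OF sublinear_dist_to[OF M]] by blast
  have le: "u x \<le> norm x" for x
    using u(2)[of x] dist_to_le[OF subspace_0[OF M], of x] by simp
  have zero: "u m = 0" if m: "m \<in> M" for m
    using u(2)[of m] u(2)[of "- m"] dist_to_le[OF m, of m]
      dist_to_le[OF subspace_neg[OF M m], of "- m"] linear_neg[OF u(1), of m] by simp
  obtain F where F: "\<And>x y. F (x + y) = F x + F y" "\<And>c x. F (smul c x) = c * F x"
    "\<And>x. norm (F x) \<le> norm x" "\<And>x. \<bar>u x\<bar> \<le> norm (F x)"
    "\<And>x. (\<forall>c. u (smul c x) = 0) \<Longrightarrow> F x = 0"
    using real_part_functional[OF u(1) le] by blast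
  show thesis
  proof (rule that[of F])
    show "dist_to M x0 \<le> norm (F x0)" using F(4)[of x0] u(3) by simp
    show "F m = 0" if "m \<in> M" for m
      using that by (intro F(5) allI zero subspace_scale[OF M])
  qed (rule F)+
qed

end

section \<open>Pointwise cluster points\<close>

text \<open>Tychonoff: the set is a product of closed discs. It is used over large index types for
  weak-star compactness and over \<open>nat\<close> for extracting subsequences.\<close>

lemma compact_bounded_functions:
  "compact {g :: 'b \<Rightarrow> 'k::real_or_complex. \<forall>x. norm (g x) \<le> C x}"
proof -
  have "compactin (product_topology (\<lambda>_::'b. euclidean :: 'k topology) UNIV)
      (Pi\<^sub>E UNIV (\<lambda>x. cball 0 (C x)))"
    by (subst compactin_PiE) (simp add: compact_cball_scalar)
  moreover have "Pi\<^sub>E UNIV (\<lambda>x. cball (0::'k) (C x)) = {g. \<forall>x. norm (g x) \<le> C x}"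
    by (auto simp: PiE_iff)
  ultimately show ?thesis
    by (simp add: euclidean_product_topology)
qed

lemma tendsto_apply:
  fixes f :: "'i \<Rightarrow> 'b \<Rightarrow> 'c::topological_space"
  assumes "(f \<longlongrightarrow> l) F"
  shows "((\<lambda>i. f i x) \<longlongrightarrow> l x) F"
  by (rule continuous_on_tendsto_compose[OF continuous_on_product_coordinates assms]) auto

text \<open>\<open>G\<close> plays the role of a subnet: \<open>F\<close> is refined by the
  preimages of the neighbourhoods of a cluster point \<open>g\<close> of the image filter, and this
  refinement is proper precisely because \<open>g\<close> is a cluster point.\<close>

lemma pointwise_cluster:
  fixes h :: "'i \<Rightarrow> 'b \<Rightarrow> 'k::real_or_complex"
  assumes "F \<noteq> bot" and "\<And>i x. norm (h i x) \<le> C x"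
  obtains G g where "G \<le> F" "G \<noteq> bot" "\<And>x. ((\<lambda>i. h i x) \<longlongrightarrow> g x) G"
proof -
  have "filtermap h F \<noteq> bot"
    using assms(1) by (simp add: filtermap_bot_iff)
  moreover have "eventually (\<lambda>g. g \<in> {g. \<forall>x. norm (g x) \<le> C x}) (filtermap h F)"
    using assms(2) by (simp add: eventually_filtermap)
  ultimately obtain g where g: "inf (nhds g) (filtermap h F) \<noteq> bot"
    using compact_bounded_functions[of C, unfolded compact_filter] by blast
  define G where "G = inf F (filtercomap h (nhds g))"
  have "G \<noteq> bot"
  proof
    assume "G = bot"
    then have "eventually (\<lambda>_. False) G" by simp
    then obtain P Q where P: "eventually P F" and Q: "eventually Q (nhds g)"
      and PQ: "\<And>i. P i \<Longrightarrow> Q (h i) \<Longrightarrow> False"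
      unfolding G_def eventually_inf eventually_filtercomap by blast
    have "eventually (\<lambda>i. \<not> Q (h i)) F"
      using P by (rule eventually_mono) (use PQ in blast)
    then have "eventually (\<lambda>y. \<not> Q y) (filtermap h F)"
      by (simp add: eventually_filtermap)
    with Q have "eventually (\<lambda>_. False) (inf (nhds g) (filtermap h F))"
      unfolding eventually_inf by blast
    with g show False by (simp add: eventually_False)
  qed
  moreover have "(h \<longlongrightarrow> g) G"
    unfolding G_def by (rule tendsto_mono[OF inf_le2 filterlim_filtercomap])
  then have "((\<lambda>i. h i x) \<longlongrightarrow> g x) G" for x by (rule tendsto_apply)
  moreover have "G \<le> F" by (simp add: G_def)
  ultimately show thesis using that by blast
qed

text \<open>Restriction to an enumeration of \<open>D\<close> moves the problem into a countable
  product, which is metrizable; compactness there is sequential and replaces an explicit diagonal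
  construction.\<close>

lemma pointwise_convergent_subsequence:
  fixes h :: "nat \<Rightarrow> 'b \<Rightarrow> 'k::real_or_complex"
  assumes D: "countable D" and bound: "\<And>n x. norm (h n x) \<le> C x"
  obtains r l where "strict_mono r" "\<And>x. x \<in> D \<Longrightarrow> (\<lambda>n. h (r n) x) \<longlonglongrightarrow> l x"
proof -
  \<comment> \<open>If \<open>D\<close> is finite or empty, \<open>e\<close> also takes filler
    values; these are harmless because \<open>bound\<close> covers every point.\<close>
  define e where "e = from_nat_into D"
  have "seq_compact {g :: nat \<Rightarrow> 'k. \<forall>i. norm (g i) \<le> C (e i)}"
    by (rule compact_imp_seq_compact[OF compact_bounded_functions])
  then obtain g :: "nat \<Rightarrow> 'k" and r where r: "strict_mono r"
    and g: "((\<lambda>n i. h n (e i)) \<circ> r) \<longlonglongrightarrow> g"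
    by (rule seq_compactE[of _ "\<lambda>n i. h n (e i)"]) (use bound in auto)
  show thesis
  proof (rule that[OF r])
    fix x assume x: "x \<in> D"
    then have "e (to_nat_on D x) = x"
      using D by (simp add: e_def)
    then show "(\<lambda>n. h (r n) x) \<longlonglongrightarrow> g (to_nat_on D x)"
      using tendsto_apply[OF g, of "to_nat_on D x"] by simp
  qed
qed

section \<open>Dual spaces\<close>

lemma norm_blinfun_le_unit:
  fixes f :: "'a::real_normed_vector \<Rightarrow>\<^sub>L 'b::real_normed_vector"
  assumes "\<And>x. norm x \<le> 1 \<Longrightarrow> norm (blinfun_apply f x) \<le> B"
  shows "norm f \<le> B"
proof (rule norm_blinfun_bound)
  show "0 \<le> B" using assms[of 0] by simp
  fix x show "norm (blinfun_apply f x) \<le> B * norm x"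
  proof (cases "x = 0")
    case False
    then show ?thesis
      using assms[of "(1 / norm x) *\<^sub>R x"] by (simp add: blinfun.scaleR_right field_simps)
  qed simp
qed

lemma norm_blinfun_apply_le:
  "norm f \<le> B \<Longrightarrow> norm x \<le> 1 \<Longrightarrow> norm (blinfun_apply f x) \<le> B"
  using norm_blinfun[of f x] mult_left_le[of "norm x" "norm f"] by simp

text \<open>Each \<open>q\<close> is tested at a point of the ball where it attains at least half
  its norm. If \<open>h\<close> vanishes at these points and \<open>q\<close> is within
  \<open>e / 3\<close> of \<open>h\<close>, then \<open>norm q \<le> 2 * (e / 3)\<close> and hence
  \<open>norm h \<le> e\<close>.\<close>

lemma countable_norming_set:
  fixes Q :: "('a::real_normed_vector \<Rightarrow>\<^sub>L 'b::real_normed_vector) set"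
  assumes "countable Q"
  obtains D where "countable D"
    "\<And>h. h \<in> closure Q \<Longrightarrow> (\<And>x. x \<in> D \<Longrightarrow> blinfun_apply h x = 0) \<Longrightarrow> h = 0"
proof -
  have "\<exists>x. norm x \<le> 1 \<and> norm q \<le> 2 * norm (blinfun_apply q x)" for q :: "'a \<Rightarrow>\<^sub>L 'b"
  proof (rule ccontr)
    assume *: "\<nexists>x. norm x \<le> 1 \<and> norm q \<le> 2 * norm (blinfun_apply q x)"
    \<comment> \<open>This forces \<open>q\<close> to be 0, for which the point 0 would have been a
      witness.\<close>
    have "norm q \<le> norm q / 2"
    proof (rule norm_blinfun_le_unit)
      fix x :: 'a assume "norm x \<le> 1"
      then have "\<not> norm q \<le> 2 * norm (blinfun_apply q x)" using * by blast
      then show "norm (blinfun_apply q x) \<le> norm q / 2" by simp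
    qed
    then show False using * by (auto dest!: spec[of _ 0])
  qed
  then obtain X :: "('a \<Rightarrow>\<^sub>L 'b) \<Rightarrow> 'a" where X: "\<And>q. norm (X q) \<le> 1"
    "\<And>q. norm q \<le> 2 * norm (blinfun_apply q (X q))"
    by metis
  show thesis
  proof (rule that[of "X ` Q"])
    fix h assume h: "h \<in> closure Q" and zero: "\<And>x. x \<in> X ` Q \<Longrightarrow> blinfun_apply h x = 0"
    have le: "norm h \<le> e" if e: "0 < e" for e
    proof -
      have "0 < e / 3" using e by simp
      then obtain q where q: "q \<in> Q" "norm (q - h) < e / 3"
        using h unfolding closure_approachable dist_norm by blast
      have "norm q \<le> 2 * norm (blinfun_apply (q - h) (X q))"
        using X(2)[of q] zero[of "X q"] q(1) by (simp add: blinfun.diff_left)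
      also have "norm (blinfun_apply (q - h) (X q)) \<le> e / 3"
        using q(2) X(1) by (intro norm_blinfun_apply_le) auto
      finally show ?thesis
        using q(2) norm_triangle_sub[of h q] by (simp add: norm_minus_commute)
    qed
    have "norm h \<le> 0" by (rule field_le_epsilon) (use le in simp)
    then show "h = 0" by simp
  qed (use assms in auto)
qed

text \<open>Finite combinations with coefficients from a countable dense set of scalars suffice;
  indexing them by lists makes countability immediate.\<close>

lemma (in normed_space_over) countable_dense_in_span:
  assumes S: "countable S"
  obtains Q where "countable Q" "span S \<subseteq> closure Q"
proof -
  obtain K :: "'k set" where K: "countable K" "closure K = UNIV"
    by (rule countable_dense_scalars)
  define Q where "Q = (\<lambda>l. sum_list (map (\<lambda>(c, x). smul c x) l)) ` lists (K \<times> S)"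
  have "countable Q"
    unfolding Q_def using S K(1) by (intro countable_image countable_lists countable_SIGMA)
  moreover have "y \<in> closure Q" if "y \<in> span S" for y
    using that
  proof (induction rule: span_induct_alt)
    case base
    have "0 \<in> Q" unfolding Q_def by (rule image_eqI[of _ _ "[]"]) auto
    then show ?case using closure_subset by blast
  next
    case (step c x y)
    show ?case
      unfolding closure_approachable
    proof (intro allI impI)
      fix e :: real assume e: "0 < e"
      obtain q where q: "q \<in> Q" "dist q y < e / 2"
        using step(2) e unfolding closure_approachable by (meson half_gt_zero)
      \<comment> \<open>The summand 1 keeps the divisor positive when \<open>x\<close> is 0.\<close>
      have "0 < norm x + 1" by (rule add_nonneg_pos) simp_all
      then have "0 < e / 2 / (norm x + 1)" using e by simp
      moreover have "c \<in> closure K" using K(2) by simp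
      ultimately obtain d where d: "d \<in> K" "dist d c < e / 2 / (norm x + 1)"
        unfolding closure_approachable by blast
      have "smul d x + q \<in> Q"
      proof -
        obtain l where l: "l \<in> lists (K \<times> S)" "q = sum_list (map (\<lambda>(c, x). smul c x) l)"
          using q(1) by (auto simp: Q_def)
        then show ?thesis
          unfolding Q_def using d(1) step(1) by (intro image_eqI[of _ _ "(d, x) # l"]) auto
      qed
      moreover have "dist (smul d x + q) (smul c x + y) < e"
      proof -
        have "norm (smul d x - smul c x) = dist d c * norm x"
          by (simp add: dist_norm norm_smul flip: scale_left_diff_distrib)
        also have "\<dots> \<le> dist d c * (norm x + 1)"
          by (intro mult_left_mono) auto
        also have "\<dots> < e / 2"
          by (rule pos_less_divide_eq[OF \<open>0 < norm x + 1\<close>, THEN iffD1, OF d(2)])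
        finally show ?thesis
          using q(2) dist_triangle_add[of "smul d x" q "smul c x" y]
          by (simp add: dist_norm)
      qed
      ultimately show "\<exists>q\<in>Q. dist q (smul c x + y) < e" by blast
    qed
  qed
  ultimately show thesis using that by blast
qed

text \<open>The scalars act on all bounded real-linear maps, among which the dual is a subspace.
  Equality of norms follows from the operator norm estimate used for \<open>c\<close> and for its
  inverse.\<close>

lemma normed_space_over_dual:
  "normed_space_over (dual_smul :: 'k::real_or_complex \<Rightarrow> ('a::banach \<Rightarrow>\<^sub>L 'k) \<Rightarrow> _)"
proof unfold_locales
  have le: "norm (dual_smul c f) \<le> norm c * norm f" for c :: 'k and f :: "'a \<Rightarrow>\<^sub>L 'k"
    by (rule norm_blinfun_bound)
      (auto simp: dual_smul_apply norm_mult mult.assoc intro!: mult_left_mono norm_blinfun)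
  fix c :: 'k and f :: "'a \<Rightarrow>\<^sub>L 'k"
  show "norm (dual_smul c f) = norm c * norm f"
  proof (cases "c = 0")
    case True
    then show ?thesis using le[of c f] by simp
  next
    case False
    have "dual_smul (inverse c) (dual_smul c f) = f"
      using False by (intro blinfun_eqI) (simp add: dual_smul_apply)
    then have "norm f \<le> norm (inverse c) * norm (dual_smul c f)"
      using le[of "inverse c" "dual_smul c f"] by simp
    then have "norm c * norm f \<le> norm c * (norm (inverse c) * norm (dual_smul c f))"
      by (rule mult_left_mono) simp
    also have "\<dots> = norm (dual_smul c f)"
      using False by (simp add: norm_inverse)
    finally have "norm c * norm f \<le> norm (dual_smul c f)" .
    with le[of c f] show ?thesis by simp
  qed
qed (rule blinfun_eqI, simp add: dual_smul_apply blinfun.add_left blinfun.scaleR_left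
      distrib_left distrib_right mult.assoc scaleR_conv_of_real)+

sublocale banach_space_over \<subseteq> normed_space_over smul
  by unfold_locales (rule smul_of_real norm_smul)+

sublocale banach_space_over \<subseteq> dual: normed_space_over "dual_smul :: 'k \<Rightarrow> ('a \<Rightarrow>\<^sub>L 'k) \<Rightarrow> _"
  by (rule normed_space_over_dual)

section \<open>Weak compactness of the unit ball and weak-star subsequences\<close>

context banach_space_over
begin

lemma subspace_dual_space: "dual.subspace (dual_space smul)"
  by (rule dual.subspaceI)
    (auto simp: dual_space_def dual_smul_apply blinfun.add_left algebra_simps)

lemma functional_in_dual:
  assumes "\<And>x y. F (x + y) = F x + F y" "\<And>c x. F (smul c x) = c * F x"
    "\<And>x. norm (F x) \<le> norm x"
  obtains f where "f \<in> dual_space smul" "norm f \<le> 1" "blinfun_apply f = F"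
proof -
  have "bounded_linear F"
  proof (rule bounded_linear_intro)
    show "F (r *\<^sub>R x) = r *\<^sub>R F x" for r x
      using assms(2)[of "of_real r" x] by (simp add: smul_of_real scaleR_conv_of_real)
    show "norm (F x) \<le> norm x * 1" for x using assms(3) by simp
  qed (rule assms(1))
  then have F: "blinfun_apply (Blinfun F) = F" by (rule bounded_linear_Blinfun_apply)
  show thesis
  proof (rule that[OF _ _ F])
    show "norm (Blinfun F) \<le> 1"
      by (rule norm_blinfun_bound) (use assms(3) in \<open>auto simp: F\<close>)
  qed (simp add: dual_space_def F assms(2))
qed

lemma norming_functional:
  obtains f where "f \<in> dual_space smul" "norm f \<le> 1" "norm x \<le> norm (blinfun_apply f x)"
proof -
  obtain F where F: "\<And>x y. F (x + y) = F x + F y" "\<And>c x. F (smul c x) = c * F x"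
    "\<And>x. norm (F x) \<le> norm x" "dist_to {0} x \<le> norm (F x)" "\<And>m. m \<in> {0} \<Longrightarrow> F m = 0"
    using hahn_banach[OF subspace_single_0, where ?x0.0 = x] by blast
  obtain f where f: "f \<in> dual_space smul" "norm f \<le> 1" "blinfun_apply f = F"
    by (rule functional_in_dual[OF F(1-3)])
  have "norm x \<le> norm (F x)" using F(4) by (simp add: dist_to_def)
  with that[OF f(1,2)] f(3) show thesis by simp
qed

text \<open>The value 0 off the dual space places the image in the product over the whole type of
  bounded maps, where Tychonoff applies.\<close>

definition bidual_embedding :: "'a \<Rightarrow> ('a \<Rightarrow>\<^sub>L 'k) \<Rightarrow> 'k" where
  "bidual_embedding x f = (if f \<in> dual_space smul then blinfun_apply f x else 0)"

text \<open>It turns weakly open covers of the ball into open covers of its image in the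
  product.\<close>

lemma openin_weak_topology_preimage:
  assumes "openin (weak_topology smul) U"
  shows "\<exists>V. open V \<and> U = bidual_embedding -` V"
  using assms[unfolded weak_topology_def openin_topology_generated_by_iff]
proof induction
  case Empty
  show ?case by (rule exI[of _ "{}"]) simp
next
  case (Int a b)
  then obtain V W where "open V" "a = bidual_embedding -` V"
    "open W" "b = bidual_embedding -` W" by blast
  then show ?case by (intro exI[of _ "V \<inter> W"]) auto
next
  case (UN K)
  then have "\<forall>k\<in>K. \<exists>V. open V \<and> k = bidual_embedding -` V" by blast
  then obtain V where V: "\<forall>k\<in>K. open (V k) \<and> k = bidual_embedding -` V k"
    by (rule bchoice[THEN exE])
  then have "(\<Union>k\<in>K. k) = (\<Union>k\<in>K. bidual_embedding -` V k)"
    by (intro SUP_cong) auto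
  then have "\<Union>K = bidual_embedding -` (\<Union>k\<in>K. V k)"
    by (simp add: vimage_UN)
  moreover have "open (\<Union>k\<in>K. V k)" using V by blast
  ultimately show ?case by blast
next
  case (Basis s)
  then obtain f U where "s = blinfun_apply f -` U" "f \<in> dual_space smul" "open U" by blast
  moreover from this have "s = bidual_embedding -` ((\<lambda>g. g f) -` U)"
    by (auto simp: bidual_embedding_def)
  ultimately show ?case
    using open_vimage[OF _ continuous_on_product_coordinates, of U f] by blast
qed

text \<open>\<open>T\<close> is the unit ball of the bidual, extended by 0: closed conditions inside
  a compact product. Reflexivity represents each member by some \<open>x\<close>, and a norming
  functional of \<open>x\<close> shows \<open>norm x \<le> 1\<close>; so \<open>T\<close> is the
  image of the ball.\<close>

lemma compactin_weak_topology_unit_ball: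
  assumes refl: "reflexive_space smul"
  shows "compactin (weak_topology smul) (cball 0 1)"
proof -
  let ?J = bidual_embedding
  define A where "A f g = {\<Phi> :: ('a \<Rightarrow>\<^sub>L 'k) \<Rightarrow> 'k. \<Phi> (f + g) = \<Phi> f + \<Phi> g}" for f g
  define B where "B c f = {\<Phi> :: ('a \<Rightarrow>\<^sub>L 'k) \<Rightarrow> 'k. \<Phi> (dual_smul c f) = c * \<Phi> f}" for c f
  define Z where "Z f = {\<Phi> :: ('a \<Rightarrow>\<^sub>L 'k) \<Rightarrow> 'k. \<Phi> f = 0}" for f
  define T where "T = {\<Phi>. \<forall>f. norm (\<Phi> f) \<le> norm f} \<inter>
    ((\<Inter>f\<in>dual_space smul. \<Inter>g\<in>dual_space smul. A f g) \<inter>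
     (\<Inter>c. \<Inter>f\<in>dual_space smul. B c f) \<inter> (\<Inter>f\<in>- dual_space smul. Z f))"
  have "closed (A f g)" "closed (B c f)" "closed (Z f)" for f g c
    unfolding A_def B_def Z_def
    by (intro closed_Collect_eq continuous_intros continuous_on_product_coordinates)+
  then have "compact T"
    unfolding T_def
    by (intro compact_Int_closed[OF compact_bounded_functions] closed_Int closed_INT ballI)
  moreover have "T = ?J ` cball 0 1"
  proof (intro equalityI subsetI)
    fix \<Phi> assume "\<Phi> \<in> T"
    then have bound: "\<And>f. norm (\<Phi> f) \<le> norm f"
      and add: "\<And>f g. f \<in> dual_space smul \<Longrightarrow> g \<in> dual_space smul \<Longrightarrow> \<Phi> (f + g) = \<Phi> f + \<Phi> g"
      and scale: "\<And>c f. f \<in> dual_space smul \<Longrightarrow> \<Phi> (dual_smul c f) = c * \<Phi> f"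
      and zero: "\<And>f. f \<notin> dual_space smul \<Longrightarrow> \<Phi> f = 0"
      by (auto simp: T_def A_def B_def Z_def)
    have "\<Phi> \<in> bidual smul"
      unfolding bidual_def using add scale bound by (auto intro!: exI[of _ 1])
    then obtain x where x: "\<And>f. f \<in> dual_space smul \<Longrightarrow> \<Phi> f = blinfun_apply f x"
      using refl unfolding reflexive_space_def by blast
    obtain f where f: "f \<in> dual_space smul" "norm f \<le> 1" "norm x \<le> norm (blinfun_apply f x)"
      by (rule norming_functional)
    then have "norm x \<le> 1" using x bound[of f] by simp
    moreover have "\<Phi> = ?J x" using x zero by (auto simp: bidual_embedding_def)
    ultimately show "\<Phi> \<in> ?J ` cball 0 1" by simp
  next
    fix \<Phi> assume "\<Phi> \<in> ?J ` cball 0 1"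
    then obtain x where x: "norm x \<le> 1" "\<Phi> = ?J x" by auto
    have "norm (?J x f) \<le> norm f" for f
      using norm_blinfun_apply_le[OF order_refl x(1), of f] by (simp add: bidual_embedding_def)
    then show "\<Phi> \<in> T"
      using dual.subspace_add[OF subspace_dual_space] dual.subspace_scale[OF subspace_dual_space]
      by (auto simp: T_def A_def B_def Z_def x(2) bidual_embedding_def blinfun.add_left dual_smul_apply)
  qed
  ultimately have JK: "compact (?J ` cball 0 1)" by simp
  show ?thesis
    unfolding compactin_def
  proof (intro conjI allI impI)
    have "0 \<in> dual_space smul" by (rule dual.subspace_0[OF subspace_dual_space])
    then have "UNIV \<in> {blinfun_apply f -` U | f U. f \<in> dual_space smul \<and> open U}"
      by (auto intro!: exI[of _ 0] exI[of _ UNIV])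
    then have "openin (weak_topology smul) UNIV"
      unfolding weak_topology_def openin_topology_generated_by_iff
      by (rule generate_topology_on.Basis)
    then show "cball 0 1 \<subseteq> topspace (weak_topology smul)"
      using openin_subset by blast
  next
    fix \<U> assume \<U>: "(\<forall>U\<in>\<U>. openin (weak_topology smul) U) \<and> cball 0 1 \<subseteq> \<Union>\<U>"
    then have "\<forall>U\<in>\<U>. \<exists>V. open V \<and> U = ?J -` V"
      using openin_weak_topology_preimage by blast
    then obtain V where V: "\<forall>U\<in>\<U>. open (V U) \<and> U = ?J -` V U"
      by (rule bchoice[THEN exE])
    have mem: "x \<in> U \<longleftrightarrow> ?J x \<in> V U" if "U \<in> \<U>" for x U
      using V that by blast
    have "?J ` cball 0 1 \<subseteq> (\<Union>U\<in>\<U>. V U)"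
    proof (rule image_subsetI)
      fix x :: 'a assume "x \<in> cball 0 1"
      then obtain U where "U \<in> \<U>" "x \<in> U" using \<U> by blast
      then show "?J x \<in> (\<Union>U\<in>\<U>. V U)" using mem by blast
    qed
    then obtain \<F> where \<F>: "\<F> \<subseteq> \<U>" "finite \<F>" "?J ` cball 0 1 \<subseteq> (\<Union>U\<in>\<F>. V U)"
      using compactE_image[OF JK, of \<U> V] V by blast
    have "cball 0 1 \<subseteq> \<Union>\<F>"
    proof
      fix x :: 'a assume "x \<in> cball 0 1"
      then obtain U where "U \<in> \<F>" "?J x \<in> V U" using \<F>(3) by blast
      then show "x \<in> \<Union>\<F>" using mem \<F>(1) by blast
    qed
    with \<F> show "\<exists>\<F>. finite \<F> \<and> \<F> \<subseteq> \<U> \<and> cball 0 1 \<subseteq> \<Union>\<F>" by blast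
  qed
qed

text \<open>Linearity and the norm bound pass to pointwise limits along \<open>G\<close>. An
  arbitrary filter is allowed so that cluster points can also be taken along a prescribed infinite
  set of indices.\<close>

lemma alaoglu:
  assumes F: "F \<noteq> bot" and h: "\<And>i. h i \<in> dual_space smul" "\<And>i. norm (h i) \<le> 1"
  obtains G g where "G \<le> F" "G \<noteq> bot" "g \<in> dual_space smul" "norm g \<le> 1"
    "\<And>x. ((\<lambda>i. blinfun_apply (h i) x) \<longlongrightarrow> blinfun_apply g x) G"
proof -
  have bound: "norm (blinfun_apply (h i) x) \<le> norm x" for i x
    using norm_blinfun[of "h i" x] mult_right_mono[OF h(2), of "norm x" i] by simp
  obtain G g where G: "G \<le> F" "G \<noteq> bot"
    and lim: "\<And>x. ((\<lambda>i. blinfun_apply (h i) x) \<longlongrightarrow> g x) G"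
    using pointwise_cluster[where h = "\<lambda>i. blinfun_apply (h i)", OF F bound] by blast
  have "g (x + y) = g x + g y" for x y
    using tendsto_add[OF lim[of x] lim[of y]] tendsto_unique[OF G(2) lim[of "x + y"]]
    by (simp add: blinfun.add_right)
  moreover have "g (smul c x) = c * g x" for c x
    using tendsto_mult_left[OF lim[of x], of c] tendsto_unique[OF G(2) lim[of "smul c x"]] h(1)
    by (simp add: dual_space_def)
  moreover have "norm (g x) \<le> norm x" for x
    by (rule tendsto_upperbound[OF tendsto_norm[OF lim] _ G(2)]) (simp add: bound)
  ultimately obtain g' where "g' \<in> dual_space smul" "norm g' \<le> 1" "blinfun_apply g' = g"
    by (rule functional_in_dual)
  with G lim that show thesis by blast
qed

text \<open>A functional on the dual that kills \<open>S\<close> and detects the distance of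
  \<open>g\<close> from its span is, by reflexivity, evaluation at some \<open>x\<close>; then
  \<open>ann\<close> makes that distance 0.\<close>

lemma closure_span_of_annihilator:
  assumes refl: "reflexive_space smul" and S: "S \<subseteq> dual_space smul" and g: "g \<in> dual_space smul"
    and ann: "\<And>x. (\<And>f. f \<in> S \<Longrightarrow> blinfun_apply f x = 0) \<Longrightarrow> blinfun_apply g x = 0"
  shows "g \<in> closure (dual.span S)"
proof -
  obtain F where F: "\<And>f h. F (f + h) = F f + F h" "\<And>c f. F (dual_smul c f) = c * F f"
    "\<And>f. norm (F f) \<le> norm f" "dist_to (dual.span S) g \<le> norm (F g)"
    "\<And>f. f \<in> dual.span S \<Longrightarrow> F f = 0"
    using dual.hahn_banach[OF dual.subspace_span, where ?x0.0 = g and S1 = S] by blast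
  have "F \<in> bidual smul"
    unfolding bidual_def using F(1-3) by (auto intro!: exI[of _ 1])
  then obtain x where x: "\<And>f. f \<in> dual_space smul \<Longrightarrow> F f = blinfun_apply f x"
    using refl unfolding reflexive_space_def by blast
  have "blinfun_apply g x = 0"
  proof (rule ann)
    fix f assume "f \<in> S"
    then show "blinfun_apply f x = 0"
      using x S F(5)[OF dual.span_base] by force
  qed
  then have le: "dist_to (dual.span S) g \<le> 0" using F(4) x[OF g] by simp
  show ?thesis
    unfolding closure_approachable
  proof (intro allI impI)
    fix e :: real assume "0 < e"
    with le have "dist_to (dual.span S) g < e" by simp
    then obtain m where "m \<in> dual.span S" "norm (g - m) < e"
      unfolding dist_to_def
      by (subst (asm) cINF_less_iff) (use dual.span_zero in \<open>auto intro: bdd_belowI2[of _ 0]\<close>)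
    then show "\<exists>m\<in>dual.span S. dist m g < e"
      by (auto simp: dist_norm norm_minus_commute)
  qed
qed

text \<open>After a diagonal argument the functionals converge on a countable set that norms the
  separable closed span of the sequence. By reflexivity the difference of two weak-star cluster
  points lies in that span, and it vanishes on the norming set, so it is zero.\<close>

theorem weak_star_convergent_subsequence:
  assumes refl: "reflexive_space smul"
    and f: "\<And>n::nat. f n \<in> dual_space smul" "\<And>n. norm (f n) \<le> 1"
  obtains r g where "strict_mono r" "g \<in> dual_space smul" "norm g \<le> 1"
    "\<And>x. (\<lambda>n. blinfun_apply (f (r n)) x) \<longlonglongrightarrow> blinfun_apply g x"
proof -
  obtain Q where Q: "countable Q" "dual.span (range f) \<subseteq> closure Q"
    by (rule dual.countable_dense_in_span[of "range f"]) auto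
  obtain D where D: "countable D"
    "\<And>h. h \<in> closure Q \<Longrightarrow> (\<And>x. x \<in> D \<Longrightarrow> blinfun_apply h x = 0) \<Longrightarrow> h = 0"
    using countable_norming_set[OF Q(1)] by blast
  have bound: "norm (blinfun_apply (f n) x) \<le> norm x" for n x
    using norm_blinfun[of "f n" x] mult_right_mono[OF f(2), of "norm x" n] by simp
  obtain r l where r: "strict_mono r"
    and l: "\<And>x. x \<in> D \<Longrightarrow> (\<lambda>n. blinfun_apply (f (r n)) x) \<longlonglongrightarrow> l x"
    by (rule pointwise_convergent_subsequence[where h = "\<lambda>n. blinfun_apply (f n)", OF D(1) bound])
      auto
  obtain G g where G: "G \<le> sequentially" "G \<noteq> bot" and g: "g \<in> dual_space smul" "norm g \<le> 1"
    and Gg: "\<And>x. ((\<lambda>n. blinfun_apply (f (r n)) x) \<longlongrightarrow> blinfun_apply g x) G"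
    using alaoglu[of sequentially "\<lambda>n. f (r n)"] f by auto
  have "(\<lambda>n. blinfun_apply (f (r n)) x) \<longlonglongrightarrow> blinfun_apply g x" for x
  proof (rule ccontr)
    assume "\<not> ?thesis"
    then obtain e where e: "0 < e"
      "\<not> (\<forall>\<^sub>F n in sequentially. dist (blinfun_apply (f (r n)) x) (blinfun_apply g x) < e)"
      unfolding tendsto_iff by blast
    \<comment> \<open>The indices where the values at \<open>x\<close> stay \<open>e\<close> away
      from the presumed limit. They form an infinite set, so a cluster point \<open>g'\<close> along
      them exists and differs from \<open>g\<close> at \<open>x\<close>.\<close>
    define N where "N = {n. e \<le> dist (blinfun_apply (f (r n)) x) (blinfun_apply g x)}"
    have "inf sequentially (principal N) \<noteq> bot"
      using e(2) by (simp add: N_def not_le eventually_inf_principal flip: eventually_False)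
    then obtain G' g' where G': "G' \<le> inf sequentially (principal N)" "G' \<noteq> bot"
      and g': "g' \<in> dual_space smul" "norm g' \<le> 1"
      and Gg': "\<And>x. ((\<lambda>n. blinfun_apply (f (r n)) x) \<longlongrightarrow> blinfun_apply g' x) G'"
      by (rule alaoglu[where h = "\<lambda>n. f (r n)", OF _ f]) (rule that)
    have "\<forall>\<^sub>F n in G'. e \<le> dist (blinfun_apply (f (r n)) x) (blinfun_apply g x)"
      using G'(1) by (auto simp: N_def le_filter_def eventually_inf_principal)
    then have far: "e \<le> dist (blinfun_apply g' x) (blinfun_apply g x)"
      by (rule tendsto_lowerbound[OF tendsto_dist[OF Gg' tendsto_const] _ G'(2)])
    have "g - g' = 0"
    proof (rule D(2))
      have diff: "g - g' \<in> dual_space smul"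
        using g(1) g'(1) by (rule dual.subspace_diff[OF subspace_dual_space])
      have "g - g' \<in> closure (dual.span (range f))"
      proof (rule closure_span_of_annihilator[OF refl _ diff])
        \<comment> \<open>A vector killed by every \<open>f n\<close> is killed by all weak-star
          cluster points.\<close>
        fix y assume "\<And>h. h \<in> range f \<Longrightarrow> blinfun_apply h y = 0"
        then have zero: "\<And>n. blinfun_apply (f (r n)) y = 0" by blast
        have "blinfun_apply g y = 0"
          by (rule tendsto_unique[OF G(2) Gg]) (simp add: zero)
        moreover have "blinfun_apply g' y = 0"
          by (rule tendsto_unique[OF G'(2) Gg']) (simp add: zero)
        ultimately show "blinfun_apply (g - g') y = 0" by (simp add: blinfun.diff_left)
      qed (use f(1) in blast)
      then show "g - g' \<in> closure Q"
        using Q(2) closure_minimal[OF _ closed_closure] by blast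
      fix y assume y: "y \<in> D"
      have "blinfun_apply g y = l y"
        by (rule tendsto_unique[OF G(2) Gg tendsto_mono[OF G(1) l[OF y]]])
      moreover have "G' \<le> sequentially" using G'(1) by simp
      then have "blinfun_apply g' y = l y"
        by (intro tendsto_unique[OF G'(2) Gg'] tendsto_mono[OF _ l[OF y]])
      ultimately show "blinfun_apply (g - g') y = 0" by (simp add: blinfun.diff_left)
    qed
    with far e(1) show False by simp
  qed
  with r g that show thesis by blast
qed

section \<open>Comparing \<open>alpha\<close> with the limit superior of the norms\<close>

lemma alpha_le_limsup_norm: "alpha smul f \<le> limsup (\<lambda>n. ennreal (norm (f n)))"
  unfolding alpha_def
proof (rule SUP_least)
  fix K assume K: "K \<in> weakly_compact_in_ball smul"
  have "(SUP x\<in>K. ennreal (norm (blinfun_apply (f n) x))) \<le> ennreal (norm (f n))" for n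
  proof (rule SUP_least)
    fix x assume "x \<in> K"
    with K have "norm x \<le> 1" by (auto simp: weakly_compact_in_ball_def)
    then show "ennreal (norm (blinfun_apply (f n) x)) \<le> ennreal (norm (f n))"
      by (intro ennreal_leI norm_blinfun_apply_le order_refl)
  qed
  then show "limsup (\<lambda>n. SUP x\<in>K. ennreal (norm (blinfun_apply (f n) x)))
      \<le> limsup (\<lambda>n. ennreal (norm (f n)))"
    by (intro Limsup_mono always_eventually) simp
qed

lemma limsup_norm_le_alpha:
  assumes "reflexive_space smul"
  shows "limsup (\<lambda>n. ennreal (norm (f n))) \<le> alpha smul f"
proof -
  have "ennreal (norm (f n)) \<le> (SUP x\<in>cball 0 1. ennreal (norm (blinfun_apply (f n) x)))"
    (is "_ \<le> ?s") for n
  proof (cases ?s)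
    case (real B)
    have "norm (f n) \<le> B"
    proof (rule norm_blinfun_le_unit)
      fix x :: 'a assume "norm x \<le> 1"
      then have "ennreal (norm (blinfun_apply (f n) x)) \<le> ?s" by (intro SUP_upper) simp
      then show "norm (blinfun_apply (f n) x) \<le> B" using real by simp
    qed
    then show ?thesis using real by (simp add: ennreal_leI)
  next
    case top
    show ?thesis unfolding top by simp
  qed
  then have "limsup (\<lambda>n. ennreal (norm (f n)))
      \<le> limsup (\<lambda>n. SUP x\<in>cball 0 1. ennreal (norm (blinfun_apply (f n) x)))"
    by (intro Limsup_mono always_eventually) simp
  also have "\<dots> \<le> alpha smul f"
    unfolding alpha_def weakly_compact_in_ball_def
    by (rule SUP_upper) (simp add: compactin_weak_topology_unit_ball[OF assms])
  finally show ?thesis .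
qed

end

section \<open>Cesaro means\<close>

lemma cesaro_tendsto_zero:
  fixes a :: "nat \<Rightarrow> 'b::real_normed_vector"
  assumes "a \<longlonglongrightarrow> 0"
  shows "cesaro a \<longlonglongrightarrow> 0"
proof (rule LIMSEQ_I)
  fix e :: real assume e: "0 < e"
  then obtain N where N: "\<And>i. N \<le> i \<Longrightarrow> norm (a i) < e / 2"
    using LIMSEQ_D[OF assms, of "e / 2"] by auto
  define B where "B = (\<Sum>i<N. norm (a i))"
  \<comment> \<open>Beyond \<open>M\<close> the fixed initial block \<open>B\<close> is less than
    half of \<open>real (Suc n) * e\<close>; the tail fills the other half.\<close>
  obtain M :: nat where M: "2 * B / e < real M" using reals_Archimedean2 by blast
  show "\<exists>m. \<forall>n\<ge>m. norm (cesaro a n - 0) < e"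
  proof (intro exI[of _ "max M N"] allI impI)
    fix n assume n: "max M N \<le> n"
    have "norm (\<Sum>i\<le>n. a i) \<le> (\<Sum>i\<le>n. norm (a i))" by (rule norm_sum)
    also have "\<dots> \<le> (\<Sum>i\<le>n. (if i < N then norm (a i) else 0) + e / 2)"
      using N e by (intro sum_mono) (auto intro: less_imp_le)
    also have "\<dots> = (\<Sum>i\<le>n. if i < N then norm (a i) else 0) + real (Suc n) * (e / 2)"
      by (simp add: sum.distrib)
    also have "(\<Sum>i\<le>n. if i < N then norm (a i) else 0) = B"
      unfolding B_def using n by (intro sum.mono_neutral_cong_right) auto
    also have "2 * B < e * real (Suc n)"
    proof -
      have "2 * B < real M * e" using M e by (simp add: field_simps)
      also have "\<dots> \<le> real (Suc n) * e" using n e by (intro mult_right_mono) auto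
      finally show ?thesis by (simp add: mult.commute)
    qed
    then have "B + real (Suc n) * (e / 2) < real (Suc n) * e" by (simp add: field_simps del: of_nat_Suc)
    finally have "norm (\<Sum>i\<le>n. a i) < real (Suc n) * e" .
    then show "norm (cesaro a n - 0) < e"
      by (simp add: cesaro_def pos_divide_less_eq mult.commute del: of_nat_Suc)
  qed
qed

lemma blinfun_apply_cesaro:
  "blinfun_apply (cesaro f n) x = cesaro (\<lambda>n. blinfun_apply (f n) x) n"
  by (simp add: cesaro_def blinfun.scaleR_left blinfun.sum_left)

lemma weak_star_null_cesaro: "weak_star_null f \<Longrightarrow> weak_star_null (cesaro f)"
  unfolding weak_star_null_def blinfun_apply_cesaro
  by (blast intro: cesaro_tendsto_zero)

lemma weak_star_null_compose:
  "weak_star_null f \<Longrightarrow> strict_mono r \<Longrightarrow> weak_star_null (f \<circ> r)"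
  unfolding weak_star_null_def
  using LIMSEQ_subseq_LIMSEQ[of "\<lambda>n. blinfun_apply (f n) _" 0 r] by (simp add: comp_def)

lemma limsup_norm_le_ca:
  fixes y :: "nat \<Rightarrow> ('a::banach \<Rightarrow>\<^sub>L 'k::real_or_complex)"
  assumes y: "weak_star_null y"
  shows "limsup (\<lambda>n. ennreal (norm (y n))) \<le> ca y"
  unfolding limsup_INF_SUP ca_def
proof (intro INF_mono bexI SUP_mono)
  fix n k :: nat assume k: "k \<in> {n..}"
  define s where "s = (SUP l\<in>{n..}. ennreal (norm (y k - y l)))"
  show "ennreal (norm (y k)) \<le> (SUP l\<in>{n..}. ennreal (norm (y k - y l)))"
    unfolding s_def[symmetric]
  proof (cases s)
    case (real B)
    have B: "norm (y k - y l) \<le> B" if "n \<le> l" for l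
    proof -
      have "ennreal (norm (y k - y l)) \<le> s" unfolding s_def using that by (intro SUP_upper) simp
      then show ?thesis using real by simp
    qed
    have "norm (y k) \<le> B"
    proof (rule norm_blinfun_le_unit)
      fix x :: 'a assume x: "norm x \<le> 1"
      \<comment> \<open>The limit in \<open>l\<close> is taken at a fixed \<open>x\<close>, since
        convergence is only pointwise; the bound \<open>B\<close> is uniform over the ball.\<close>
      have "(\<lambda>l. norm (blinfun_apply (y k) x - blinfun_apply (y l) x))
          \<longlonglongrightarrow> norm (blinfun_apply (y k) x - 0)"
        using y unfolding weak_star_null_def by (intro tendsto_intros) blast
      then have "norm (blinfun_apply (y k) x - 0) \<le> B"
      proof (rule tendsto_upperbound)
        show "\<forall>\<^sub>F l in sequentially. norm (blinfun_apply (y k) x - blinfun_apply (y l) x) \<le> B"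
          using norm_blinfun_apply_le[OF B x]
          by (auto simp: eventually_sequentially blinfun.diff_left)
      qed simp
      then show "norm (blinfun_apply (y k) x) \<le> B" by simp
    qed
    then show "ennreal (norm (y k)) \<le> s" using real by (simp add: ennreal_leI)
  qed simp
qed auto

text \<open>Multiplication by a nonzero finite \<open>c\<close> is an order isomorphism with inverse
  division by \<open>c\<close>. This moves the factor 4 past the infima in \<open>limsup\<close> and
  in \<open>mu_s\<close>.\<close>

lemma le_mult_INF_ennreal:
  fixes c :: ennreal
  assumes c: "c \<noteq> 0" "c \<noteq> top" and le: "\<And>i. i \<in> I \<Longrightarrow> a \<le> c * f i"
  shows "a \<le> c * (INF i\<in>I. f i)"
proof -
  have a: "c * (a / c) = a"
    using ennreal_mult_divide_eq[OF c, of a] by (simp add: ennreal_times_divide mult.commute)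
  have "a / c \<le> (INF i\<in>I. f i)"
  proof (rule INF_greatest)
    fix i assume "i \<in> I"
    then have "c * (a / c) \<le> c * f i" unfolding a by (rule le)
    then show "a / c \<le> f i" by (simp only: ennreal_mult_le_mult_iff[OF c])
  qed
  then have "c * (a / c) \<le> c * (INF i\<in>I. f i)" by (rule mult_left_mono) simp
  then show ?thesis unfolding a .
qed

lemma ca_le_limsup_norm:
  fixes x y :: "nat \<Rightarrow> 'b::real_normed_vector"
  assumes "\<And>k l. norm (x k - x l) \<le> 2 * norm (y k - y l)"
  shows "ca x \<le> 4 * limsup (\<lambda>n. ennreal (norm (y n)))"
  unfolding limsup_INF_SUP
proof (rule le_mult_INF_ennreal)
  fix n :: nat
  define s where "s = (SUP m\<in>{n..}. ennreal (norm (y m)))"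
  have s: "ennreal (norm (y m)) \<le> s" if "n \<le> m" for m
    unfolding s_def using that by (intro SUP_upper) simp
  have "ca x \<le> (SUP k\<in>{n..}. SUP l\<in>{n..}. ennreal (norm (x k - x l)))"
    unfolding ca_def by (rule INF_lower) simp
  also have "\<dots> \<le> 4 * s"
  proof (intro SUP_least)
    fix k l assume kl: "k \<in> {n..}" "l \<in> {n..}"
    have "norm (x k - x l) \<le> 2 * (norm (y k) + norm (y l))"
      using assms[of k l] norm_triangle_ineq4[of "y k" "y l"] by simp
    then have "ennreal (norm (x k - x l)) \<le> ennreal (2 * (norm (y k) + norm (y l)))"
      by (rule ennreal_leI)
    also have "\<dots> = 2 * (ennreal (norm (y k)) + ennreal (norm (y l)))"
      by (subst ennreal_mult) simp_all
    also have "\<dots> \<le> 2 * (s + s)"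
      using kl by (intro mult_left_mono add_mono s) auto
    also have "\<dots> = 4 * s" by (simp flip: mult_2 mult.assoc)
    finally show "ennreal (norm (x k - x l)) \<le> 4 * s" .
  qed
  finally show "ca x \<le> 4 * (SUP m\<in>{n..}. ennreal (norm (y m)))" unfolding s_def .
qed simp_all

text \<open>Cesaro means commute with affine maps, and the constant \<open>g\<close> cancels in
  differences.\<close>

lemma cca_le_of_affine:
  fixes x h :: "nat \<Rightarrow> 'b::real_normed_vector"
  assumes x: "\<And>n. x n = g + 2 *\<^sub>R h n"
  shows "cca x \<le> 4 * limsup (\<lambda>n. ennreal (norm (cesaro h n)))"
  unfolding cca_def
proof (rule ca_le_limsup_norm)
  have "cesaro x n = g + 2 *\<^sub>R cesaro h n" for n
    by (simp add: cesaro_def x sum.distrib scaleR_add_right sum_constant_scaleR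
        flip: scaleR_sum_right del: of_nat_Suc)
  then show "norm (cesaro x k - cesaro x l) \<le> 2 * norm (cesaro h k - cesaro h l)" for k l
    by (simp flip: scaleR_diff_right)
qed

section \<open>The two inequalities\<close>

context banach_space_over
begin

lemma c_alpha_le_cca: "weak_star_null h \<Longrightarrow> c_alpha smul h \<le> cca h"
  unfolding c_alpha_def cca_def
  by (rule order_trans[OF alpha_le_limsup_norm limsup_norm_le_ca[OF weak_star_null_cesaro]])

text \<open>Weak-star nullity is inherited by subsequences, so the comparison holds termwise; the
  supremum in \<open>bs\<close> then runs over a larger family.\<close>

lemma mu_s_le_bs: "mu_s smul \<le> bs (dual_space smul)"
  unfolding mu_s_def bs_def
proof (rule SUP_mono)
  fix f assume f: "f \<in> {f. (\<forall>n. f n \<in> dual_space smul \<inter> cball 0 1) \<and> weak_star_null f}"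
  have "(INF g\<in>subsequences f. SUP h\<in>subsequences g. c_alpha smul h)
      \<le> (INF g\<in>subsequences f. SUP h\<in>subsequences g. cca h)"
  proof (intro INF_mono bexI SUP_mono)
    fix g h assume "g \<in> subsequences f" "h \<in> subsequences g"
    then have "weak_star_null h"
      using f by (auto simp: subsequences_def intro!: weak_star_null_compose)
    then show "c_alpha smul h \<le> cca h" by (rule c_alpha_le_cca)
  qed
  then show "\<exists>x\<in>{x. \<forall>n. x n \<in> dual_space smul \<inter> cball 0 1}.
      (INF g\<in>subsequences f. SUP h\<in>subsequences g. c_alpha smul h)
      \<le> (INF y\<in>subsequences x. SUP z\<in>subsequences y. cca z)"
    using f by (intro bexI[of _ f]) auto
qed

text \<open>Since \<open>x (r n) = g + 2 *\<^sub>R h0 n\<close>, subsequences of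
  \<open>x \<circ> r\<close> and of \<open>h0\<close> correspond index by index, which lets the
  nested infimum and supremum be compared termwise.\<close>

lemma bs_le_mu_s:
  assumes refl: "reflexive_space smul"
  shows "bs (dual_space smul) \<le> 4 * mu_s smul"
  unfolding bs_def
proof (rule SUP_least)
  fix x :: "nat \<Rightarrow> 'a \<Rightarrow>\<^sub>L 'k" assume "x \<in> {x. \<forall>n. x n \<in> dual_space smul \<inter> cball 0 1}"
  then have x: "\<And>n. x n \<in> dual_space smul" "\<And>n. norm (x n) \<le> 1" by auto
  obtain r g where r: "strict_mono r" and g: "g \<in> dual_space smul" "norm g \<le> 1"
    and lim: "\<And>v. (\<lambda>n. blinfun_apply (x (r n)) v) \<longlonglongrightarrow> blinfun_apply g v"
    by (rule weak_star_convergent_subsequence[where f = x, OF refl x]) (rule that)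
  define h0 where "h0 n = (1 / 2) *\<^sub>R (x (r n) - g)" for n
  have "h0 n \<in> dual_space smul" for n
    unfolding h0_def dual.smul_of_real[symmetric]
    by (intro dual.subspace_scale[OF subspace_dual_space]
        dual.subspace_diff[OF subspace_dual_space] x g)
  moreover have "norm (h0 n) \<le> 1" for n
    using norm_triangle_ineq4[of "x (r n)" g] x(2)[of "r n"] g(2) by (simp add: h0_def)
  moreover have "weak_star_null h0"
    unfolding weak_star_null_def
  proof
    fix v
    show "(\<lambda>n. blinfun_apply (h0 n) v) \<longlonglongrightarrow> 0"
      using tendsto_scaleR[OF tendsto_const LIM_zero[OF lim[of v]], of "1 / 2"]
      by (simp add: h0_def blinfun.scaleR_left blinfun.diff_left)
  qed
  ultimately have "(INF g\<in>subsequences h0. SUP h\<in>subsequences g. c_alpha smul h) \<le> mu_s smul"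
    unfolding mu_s_def by (intro SUP_upper) simp
  then have mu: "4 * (INF g\<in>subsequences h0. SUP h\<in>subsequences g. c_alpha smul h)
      \<le> 4 * mu_s smul"
    by (rule mult_left_mono) simp
  have "(INF y\<in>subsequences x. SUP z\<in>subsequences y. cca z)
      \<le> 4 * (INF g\<in>subsequences h0. SUP h\<in>subsequences g. c_alpha smul h)"
  proof (rule le_mult_INF_ennreal)
    fix g' assume "g' \<in> subsequences h0"
    then obtain s where s: "strict_mono s" "g' = h0 \<circ> s" by (auto simp: subsequences_def)
    have "(INF y\<in>subsequences x. SUP z\<in>subsequences y. cca z)
        \<le> (SUP z\<in>subsequences (x \<circ> (r \<circ> s)). cca z)"
      using strict_mono_o[OF r s(1)] by (intro INF_lower) (auto simp: subsequences_def)
    also have "\<dots> \<le> 4 * (SUP h\<in>subsequences g'. c_alpha smul h)"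
    proof (rule SUP_least)
      fix z assume "z \<in> subsequences (x \<circ> (r \<circ> s))"
      then obtain t where t: "strict_mono t" "z = x \<circ> (r \<circ> s) \<circ> t"
        by (auto simp: subsequences_def)
      define h where "h = g' \<circ> t"
      have "cca z \<le> 4 * limsup (\<lambda>n. ennreal (norm (cesaro h n)))"
        by (rule cca_le_of_affine[where g = g]) (simp add: t(2) h_def s(2) h0_def)
      also have "\<dots> \<le> 4 * c_alpha smul h"
        unfolding c_alpha_def by (intro mult_left_mono limsup_norm_le_alpha[OF refl]) simp
      also have "\<dots> \<le> 4 * (SUP h\<in>subsequences g'. c_alpha smul h)"
      proof (intro mult_left_mono SUP_upper)
        show "h \<in> subsequences g'" using t(1) unfolding h_def subsequences_def by blast
      qed simp
      finally show "cca z \<le> 4 * (SUP h\<in>subsequences g'. c_alpha smul h)" .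
    qed
    finally show "(INF y\<in>subsequences x. SUP z\<in>subsequences y. cca z)
        \<le> 4 * (SUP h\<in>subsequences g'. c_alpha smul h)" .
  qed simp_all
  then show "(INF y\<in>subsequences x. SUP z\<in>subsequences y. cca z) \<le> 4 * mu_s smul"
    using mu by (rule order_trans)
qed

end

theorem theorem5p5:
  fixes smul :: "'k::real_or_complex \<Rightarrow> 'a::banach \<Rightarrow> 'a"
  assumes "banach_space_over smul"
    and "infinite_dimensional smul"
    and "reflexive_space smul"
  shows "mu_s smul \<le> bs (dual_space smul) \<and> bs (dual_space smul) \<le> 4 * mu_s smul"
  using banach_space_over.mu_s_le_bs[OF assms(1)] banach_space_over.bs_le_mu_s[OF assms(1,3)] ..

end
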